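(* Let $$E:\ B\xrightarrow{\,k\,}E\xrightarrow{\,f\,}C,\qquad E':\ B'\xrightarrow{\,k'\,}E'\xrightarrow{\,f'\,}C'$$ be two group extensions with abelian kernels $B$ and $B'$, with induced module structures $\xi$ (of $C$ on $B$) and $\xi'$ (of $C'$ on $B'$), and let $(\varphi_0,\varphi_1)\colon\xi\to\xi'$ be a morphism of group modules. Then: (i) There exist morphisms of extensions $E\to E'$ which induce $(\varphi_0,\varphi_1)$ if and only if $\varphi_0^*E'\cong\varphi_{1*}E$ as extensions of $C$ by $B'$ (by an isomorphism that is the identity on $B'$ and on $C$). (ii) In this case, the set $\mathsf{OPEXT}_{(\varphi_0,\varphi_1)}(E,E')$ of morphisms of extensions $E\to E'$ inducing $(\varphi_0,\varphi_1)$ is a simply transitive $\mathcal Z^1(C,B',\varphi_0^*\xi')$-set.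
   Context: A group extension with abelian kernel is a short exact sequence $0\to B\xrightarrow{k}E\xrightarrow{f}C\to 1$ of groups with $B$ abelian; it induces a $C$-module structure $\xi\colon C\times B\to B$ on $B$ by conjugation in $E$. A morphism of extensions $E\to E'$ is a morphism of short exact sequences; it induces the pair $(\varphi_0,\varphi_1)$ of its components $\varphi_0\colon C\to C'$ and $\varphi_1\colon B\to B'$. A morphism of group modules $(\varphi_0,\varphi_1)\colon\xi\to\xi'$ is a pair of homomorphisms $\varphi_0\colon C\to C'$, $\varphi_1\colon B\to B'$ with $\varphi_1(c*b)=\varphi_0(c)*\varphi_1(b)$. $\varphi_0^*\xi'$ is the $C$-module structure on $B'$ given by $c*b'=\varphi_0(c)*b'$. $\varphi_0^*E'$ is the extension $B'\to E'\times_{C'}C\to C$ obtained by pulling back $f'$ along $\varphi_0$; it induces $\varphi_0^*\xi'$. $\varphi_{1*}E$ is the push forward of $E$ along the $C$-module map $\varphi_1\colon(B,\xi)\to(B',\varphi_0^*\xi')$: the extension $B'\to(B'\rtimes E)/\{(-\varphi_1(b),k(b)):b\in B\}\to C$, where $E$ acts on $B'$ through $f$ and $\varphi_0^*\xi'$; it is the codomain of an opcartesian lifting of $\varphi_1$ at $E$ (for the functor from extensions of $C$ to $C$-modules). $\mathcal Z^1(C,B',\varphi_0^*\xi')$ is the abelian group (under pointwise addition) of crossed homomorphisms, i.e. maps $\sigma\colon C\to B'$ with $\sigma(cc')=\sigma(c)+c*\sigma(c')$. It is isomorphic to the group of automorphisms of the extension $\varphi_0^*E'$ that are the identity on $B'$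 and $C$. A simply transitive $\Gamma$-set is a set on which the group $\Gamma$ acts so that for any two elements exactly one group element carries the first to the second. *)

theory Defs
  imports "HOL-Algebra.Group_Action"
begin

text \<open>
  All groups are multiplicative records of HOL-Algebra. In particular the abelian kernels,
  which one usually writes additively, appear here in multiplicative notation.
  A module structure is a curried function \<^typ>\<open>'c \<Rightarrow> 'b \<Rightarrow> 'b\<close>, of which only the values on
  the carriers matter.
\<close>

record ('b, 'e, 'c) group_ext =
  Ker :: "'b monoid"
  Tot :: "'e monoid"
  Quo :: "'c monoid"
  incl :: "'b \<Rightarrow> 'e"
  prj :: "'e \<Rightarrow> 'c"

definition abelian_extension :: "('b, 'e, 'c) group_ext \<Rightarrow> bool" where
  "abelian_extension X \<longleftrightarrow>
     comm_group (Ker X) \<and> group (Tot X) \<and> group (Quo X) \<and>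
     incl X \<in> mon (Ker X) (Tot X) \<and> prj X \<in> epi (Tot X) (Quo X) \<and>
     incl X ` carrier (Ker X) = kernel (Tot X) (Quo X) (prj X)"

text \<open>\<open>c * b\<close> is the element whose image is \<open>e k(b) e\<^sup>-\<^sup>1\<close>, for any \<open>e\<close> over \<open>c\<close>; it does not
  depend on the choice of \<open>e\<close> because the kernel is abelian.\<close>

definition induced_module :: "('b, 'e, 'c) group_ext \<Rightarrow> 'c \<Rightarrow> 'b \<Rightarrow> 'b" where
  "induced_module X c b =
     (THE b'. b' \<in> carrier (Ker X) \<and>
        (\<exists>e \<in> carrier (Tot X). prj X e = c \<and>
           incl X b' = e \<otimes>\<^bsub>Tot X\<^esub> incl X b \<otimes>\<^bsub>Tot X\<^esub> inv\<^bsub>Tot X\<^esub> e))"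

definition module_morphism ::
  "'c monoid \<Rightarrow> 'b monoid \<Rightarrow> ('c \<Rightarrow> 'b \<Rightarrow> 'b) \<Rightarrow>
   'c2 monoid \<Rightarrow> 'b2 monoid \<Rightarrow> ('c2 \<Rightarrow> 'b2 \<Rightarrow> 'b2) \<Rightarrow>
   ('c \<Rightarrow> 'c2) \<Rightarrow> ('b \<Rightarrow> 'b2) \<Rightarrow> bool" where
  "module_morphism C B \<xi> C' B' \<xi>' \<phi>0 \<phi>1 \<longleftrightarrow>
     \<phi>0 \<in> hom C C' \<and> \<phi>1 \<in> hom B B' \<and>
     (\<forall>c \<in> carrier C. \<forall>b \<in> carrier B. \<phi>1 (\<xi> c b) = \<xi>' (\<phi>0 c) (\<phi>1 b))"

definition pullback_module :: "('c \<Rightarrow> 'c2) \<Rightarrow> ('c2 \<Rightarrow> 'b \<Rightarrow> 'b) \<Rightarrow> 'c \<Rightarrow> 'b \<Rightarrow> 'b" where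
  "pullback_module \<phi>0 \<xi>' = (\<lambda>c b. \<xi>' (\<phi>0 c) b)"

definition ext_morphism ::
  "('b, 'e, 'c) group_ext \<Rightarrow> ('b2, 'e2, 'c2) group_ext \<Rightarrow>
   ('b \<Rightarrow> 'b2) \<Rightarrow> ('e \<Rightarrow> 'e2) \<Rightarrow> ('c \<Rightarrow> 'c2) \<Rightarrow> bool" where
  "ext_morphism X Y \<alpha> \<gamma> \<beta> \<longleftrightarrow>
     \<alpha> \<in> hom (Ker X) (Ker Y) \<and> \<gamma> \<in> hom (Tot X) (Tot Y) \<and> \<beta> \<in> hom (Quo X) (Quo Y) \<and>
     (\<forall>b \<in> carrier (Ker X). \<gamma> (incl X b) = incl Y (\<alpha> b)) \<and>
     (\<forall>e \<in> carrier (Tot X). prj Y (\<gamma> e) = \<beta> (prj X e))"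

definition ext_iso :: "('b, 'e, 'c) group_ext \<Rightarrow> ('b, 'e2, 'c) group_ext \<Rightarrow> bool" where
  "ext_iso X Y \<longleftrightarrow>
     Ker X = Ker Y \<and> Quo X = Quo Y \<and>
     (\<exists>\<gamma> \<in> iso (Tot X) (Tot Y). ext_morphism X Y (\<lambda>b. b) \<gamma> (\<lambda>c. c))"

text \<open>A morphism inducing \<open>(\<phi>0, \<phi>1)\<close> is determined by its middle component. Middle components
  are taken extensional, so that equality in this set is equality of group homomorphisms.\<close>

definition OPEXT ::
  "('c \<Rightarrow> 'c2) \<Rightarrow> ('b \<Rightarrow> 'b2) \<Rightarrow> ('b, 'e, 'c) group_ext \<Rightarrow> ('b2, 'e2, 'c2) group_ext \<Rightarrow>
   ('e \<Rightarrow> 'e2) set" where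
  "OPEXT \<phi>0 \<phi>1 X Y = {\<gamma> \<in> extensional (carrier (Tot X)). ext_morphism X Y \<phi>1 \<gamma> \<phi>0}"

definition pullback_ext ::
  "'c monoid \<Rightarrow> ('c \<Rightarrow> 'c2) \<Rightarrow> ('b, 'e, 'c2) group_ext \<Rightarrow> ('b, 'e \<times> 'c, 'c) group_ext" where
  "pullback_ext C \<phi>0 Y =
     \<lparr> Ker = Ker Y,
       Tot = (Tot Y \<times>\<times> C)
         \<lparr> carrier := {(e, c). e \<in> carrier (Tot Y) \<and> c \<in> carrier C \<and> prj Y e = \<phi>0 c} \<rparr>,
       Quo = C,
       incl = (\<lambda>b. (incl Y b, \<one>\<^bsub>C\<^esub>)),
       prj = snd \<rparr>"

definition semidirect :: "'b monoid \<Rightarrow> 'e monoid \<Rightarrow> ('e \<Rightarrow> 'b \<Rightarrow> 'b) \<Rightarrow> ('b \<times> 'e) monoid" where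
  "semidirect B E act =
     \<lparr> carrier = carrier B \<times> carrier E,
       mult = (\<lambda>(b, e) (b', e'). (b \<otimes>\<^bsub>B\<^esub> act e b', e \<otimes>\<^bsub>E\<^esub> e')),
       one = (\<one>\<^bsub>B\<^esub>, \<one>\<^bsub>E\<^esub>) \<rparr>"

text \<open>The push forward of \<open>X\<close> along a homomorphism \<open>\<phi>1\<close> of modules over \<open>Quo X\<close>, with target
  \<open>B'\<close> and module structure \<open>\<eta>\<close> on the target. The projection sends a coset to \<open>f e\<close>, for any
  \<open>(b', e)\<close> in it.\<close>

definition pushforward_ext ::
  "'b2 monoid \<Rightarrow> ('c \<Rightarrow> 'b2 \<Rightarrow> 'b2) \<Rightarrow> ('b \<Rightarrow> 'b2) \<Rightarrow> ('b, 'e, 'c) group_ext \<Rightarrow>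
   ('b2, ('b2 \<times> 'e) set, 'c) group_ext" where
  "pushforward_ext B' \<eta> \<phi>1 X =
     (let S = semidirect B' (Tot X) (\<lambda>e. \<eta> (prj X e));
          N = {(inv\<^bsub>B'\<^esub> (\<phi>1 b), incl X b) | b. b \<in> carrier (Ker X)}
      in \<lparr> Ker = B',
           Tot = S Mod N,
           Quo = Quo X,
           incl = (\<lambda>b'. N #>\<^bsub>S\<^esub> (b', \<one>\<^bsub>Tot X\<^esub>)),
           prj = (\<lambda>A. the_elem ((\<lambda>(b', e). prj X e) ` A)) \<rparr>)"

definition crossed_homs :: "'c monoid \<Rightarrow> 'b monoid \<Rightarrow> ('c \<Rightarrow> 'b \<Rightarrow> 'b) \<Rightarrow> ('c \<Rightarrow> 'b) monoid" where
  "crossed_homs C B \<eta> =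
     \<lparr> carrier = {\<sigma> \<in> carrier C \<rightarrow>\<^sub>E carrier B.
          \<forall>c \<in> carrier C. \<forall>c' \<in> carrier C. \<sigma> (c \<otimes>\<^bsub>C\<^esub> c') = \<sigma> c \<otimes>\<^bsub>B\<^esub> \<eta> c (\<sigma> c')},
       mult = (\<lambda>\<sigma> \<tau>. \<lambda>c \<in> carrier C. \<sigma> c \<otimes>\<^bsub>B\<^esub> \<tau> c),
       one = (\<lambda>c \<in> carrier C. \<one>\<^bsub>B\<^esub>) \<rparr>"

text \<open>A crossed homomorphism \<open>\<sigma>\<close> corresponds to the automorphism \<open>(x, c) \<mapsto> (k'(\<sigma> c) x, c)\<close> of the
  pullback extension, and morphisms \<open>\<gamma>\<close> in \<open>OPEXT \<phi>0 \<phi>1 X Y\<close> correspond to morphisms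
  \<open>e \<mapsto> (\<gamma> e, f e)\<close> into the pullback extension. The following action is composition of the
  latter with the former.\<close>

definition OPEXT_action ::
  "('c \<Rightarrow> 'c2) \<Rightarrow> ('b \<Rightarrow> 'b2) \<Rightarrow> ('b, 'e, 'c) group_ext \<Rightarrow> ('b2, 'e2, 'c2) group_ext \<Rightarrow>
   ('c \<Rightarrow> 'b2) \<Rightarrow> ('e \<Rightarrow> 'e2) \<Rightarrow> ('e \<Rightarrow> 'e2)" where
  "OPEXT_action \<phi>0 \<phi>1 X Y \<sigma> =
     (\<lambda>\<gamma> \<in> OPEXT \<phi>0 \<phi>1 X Y. \<lambda>e \<in> carrier (Tot X). incl Y (\<sigma> (prj X e)) \<otimes>\<^bsub>Tot Y\<^esub> \<gamma> e)"

locale simply_transitive_action = group_action +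
  assumes simply_transitive:
    "\<lbrakk> x \<in> E; y \<in> E \<rbrakk> \<Longrightarrow> \<exists>!g. g \<in> carrier G \<and> \<phi> g x = y"

end

theory Submission
  imports Defs
begin

text \<open>
  A morphism \<open>\<gamma>\<close> from \<open>X\<close> to \<open>Y\<close> inducing \<open>(\<phi>0, \<phi>1)\<close> yields the surjective homomorphism
  \<open>(y, e) \<mapsto> (k' y \<cdot> \<gamma> e, f e)\<close> from the semidirect product onto the pullback. Its kernel is the
  subgroup defining the push forward, so the first isomorphism theorem identifies the two
  extensions. Conversely, a map from the push forward to the pullback, precomposed with
  \<open>e \<mapsto> [(1, e)]\<close> and followed by the first projection, is such a \<open>\<gamma>\<close>. Two morphisms
  \<open>\<gamma>\<close>, \<open>\<delta>\<close> differ by \<open>\<delta> e = k' (\<sigma> (f e)) \<cdot> \<gamma> e\<close>: the quotient lies over 1 and is unchanged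
  when \<open>e\<close> moves in its fibre, because \<open>\<gamma>\<close> and \<open>\<delta>\<close> agree on \<open>B\<close> and \<open>B'\<close> is abelian;
  multiplicativity of \<open>\<delta>\<close> is the crossed homomorphism law for \<open>\<sigma>\<close>.
\<close>

section \<open>Group modules and crossed homomorphisms\<close>

text \<open>\<open>Ker Y\<close> is acted on by \<open>Quo Y\<close>, by \<open>Quo X\<close>
  through \<open>\<phi>0\<close>, and by \<open>Tot X\<close> through \<open>prj X\<close> as well.
  Working with an arbitrary acting group lets one treatment of semidirect products and crossed
  homomorphisms serve wherever it is needed.\<close>

locale group_module = C: group C + B: comm_group B
  for C :: "'c monoid" and B :: "'b monoid" and \<eta> :: "'c \<Rightarrow> 'b \<Rightarrow> 'b" +
  assumes act_hom: "c \<in> carrier C \<Longrightarrow> \<eta> c \<in> hom B B"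
    and act_one: "b \<in> carrier B \<Longrightarrow> \<eta> \<one>\<^bsub>C\<^esub> b = b"
    and act_comp: "\<lbrakk>c \<in> carrier C; d \<in> carrier C; b \<in> carrier B\<rbrakk> \<Longrightarrow> \<eta> (c \<otimes>\<^bsub>C\<^esub> d) b = \<eta> c (\<eta> d b)"
begin

lemma act_closed [simp]: "\<lbrakk>c \<in> carrier C; b \<in> carrier B\<rbrakk> \<Longrightarrow> \<eta> c b \<in> carrier B"
  using act_hom hom_in_carrier by metis

lemma act_mult:
  "\<lbrakk>c \<in> carrier C; a \<in> carrier B; b \<in> carrier B\<rbrakk> \<Longrightarrow> \<eta> c (a \<otimes>\<^bsub>B\<^esub> b) = \<eta> c a \<otimes>\<^bsub>B\<^esub> \<eta> c b"
  using act_hom by (auto simp: hom_def)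

lemma act_group_hom: "c \<in> carrier C \<Longrightarrow> group_hom B B (\<eta> c)"
  by (simp add: act_hom group_hom.intro group_hom_axioms.intro)

lemma act_unit: "c \<in> carrier C \<Longrightarrow> \<eta> c \<one>\<^bsub>B\<^esub> = \<one>\<^bsub>B\<^esub>"
  by (rule group_hom.hom_one[OF act_group_hom])

lemma act_inv: "\<lbrakk>c \<in> carrier C; b \<in> carrier B\<rbrakk> \<Longrightarrow> \<eta> c (inv\<^bsub>B\<^esub> b) = inv\<^bsub>B\<^esub> (\<eta> c b)"
  by (rule group_hom.hom_inv[OF act_group_hom])

lemma pullback:
  assumes "group D" and "\<phi> \<in> hom D C"
  shows "group_module D B (pullback_module \<phi> \<eta>)"
proof -
  interpret group_hom D C \<phi>
    using assms by (simp add: group_hom.intro group_hom_axioms.intro C.is_group)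
  show ?thesis
    by unfold_locales (simp_all add: pullback_module_def act_hom act_one act_comp)
qed

lemma group_semidirect: "group (semidirect B C \<eta>)"
proof (rule groupI)
  fix x assume "x \<in> carrier (semidirect B C \<eta>)"
  then obtain b c where x: "x = (b, c)" "b \<in> carrier B" "c \<in> carrier C"
    by (auto simp: semidirect_def)
  \<comment> \<open>\<open>groupI\<close> asks for a left inverse. Its first component is chosen so
    that the product has first component \<open>\<eta> (inv c)\<close> applied to
    \<open>inv b \<otimes> b\<close>, which is the unit.\<close>
  then have "(\<eta> (inv\<^bsub>C\<^esub> c) (inv\<^bsub>B\<^esub> b), inv\<^bsub>C\<^esub> c) \<otimes>\<^bsub>semidirect B C \<eta>\<^esub> x = \<one>\<^bsub>semidirect B C \<eta>\<^esub>"
    by (simp add: semidirect_def act_unit act_mult[symmetric])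
  then show "\<exists>y\<in>carrier (semidirect B C \<eta>). y \<otimes>\<^bsub>semidirect B C \<eta>\<^esub> x = \<one>\<^bsub>semidirect B C \<eta>\<^esub>"
    by (rule bexI) (use x in \<open>simp add: semidirect_def\<close>)
qed (auto simp: semidirect_def act_one act_comp act_mult B.m_assoc C.m_assoc)

lemma crossed_homs_mem:
  "\<sigma> \<in> carrier (crossed_homs C B \<eta>) \<longleftrightarrow> \<sigma> \<in> carrier C \<rightarrow>\<^sub>E carrier B \<and>
    (\<forall>c\<in>carrier C. \<forall>d\<in>carrier C. \<sigma> (c \<otimes>\<^bsub>C\<^esub> d) = \<sigma> c \<otimes>\<^bsub>B\<^esub> \<eta> c (\<sigma> d))"
  by (simp add: crossed_homs_def)

lemma crossed_homs_mult: "\<sigma> \<otimes>\<^bsub>crossed_homs C B \<eta>\<^esub> \<tau> = (\<lambda>c\<in>carrier C. \<sigma> c \<otimes>\<^bsub>B\<^esub> \<tau> c)"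
  by (simp add: crossed_homs_def)

lemma crossed_homs_one: "\<one>\<^bsub>crossed_homs C B \<eta>\<^esub> = (\<lambda>c\<in>carrier C. \<one>\<^bsub>B\<^esub>)"
  by (simp add: crossed_homs_def)

lemma crossed_hom_restrict: "\<sigma> \<in> carrier (crossed_homs C B \<eta>) \<Longrightarrow> restrict \<sigma> (carrier C) = \<sigma>"
  by (simp add: crossed_homs_mem PiE_def extensional_restrict)

lemma crossed_hom_closed: "\<lbrakk>\<sigma> \<in> carrier (crossed_homs C B \<eta>); c \<in> carrier C\<rbrakk> \<Longrightarrow> \<sigma> c \<in> carrier B"
  by (auto simp: crossed_homs_mem)

lemma crossed_hom_mult:
  "\<lbrakk>\<sigma> \<in> carrier (crossed_homs C B \<eta>); c \<in> carrier C; d \<in> carrier C\<rbrakk>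
    \<Longrightarrow> \<sigma> (c \<otimes>\<^bsub>C\<^esub> d) = \<sigma> c \<otimes>\<^bsub>B\<^esub> \<eta> c (\<sigma> d)"
  by (simp add: crossed_homs_mem)

lemma crossed_hom_one:
  assumes "\<sigma> \<in> carrier (crossed_homs C B \<eta>)"
  shows "\<sigma> \<one>\<^bsub>C\<^esub> = \<one>\<^bsub>B\<^esub>"
  using crossed_hom_mult[OF assms C.one_closed C.one_closed] crossed_hom_closed[OF assms C.one_closed]
  by (simp add: act_one)

text \<open>Commutativity of \<open>B\<close> makes a pointwise product crossed again:
  \<open>\<tau> c\<close> has to change places with \<open>\<eta> c (\<sigma> d)\<close>.\<close>

lemma comm_group_crossed_homs: "comm_group (crossed_homs C B \<eta>)"
proof (rule comm_groupI)
  fix \<sigma> \<tau> assume "\<sigma> \<in> carrier (crossed_homs C B \<eta>)" "\<tau> \<in> carrier (crossed_homs C B \<eta>)"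
  then show "\<sigma> \<otimes>\<^bsub>crossed_homs C B \<eta>\<^esub> \<tau> \<in> carrier (crossed_homs C B \<eta>)"
    by (subst crossed_homs_mem)
      (auto simp: crossed_homs_mult crossed_hom_closed crossed_hom_mult act_mult B.m_ac)
next
  fix \<sigma> assume \<sigma>: "\<sigma> \<in> carrier (crossed_homs C B \<eta>)"
  let ?\<tau> = "\<lambda>c\<in>carrier C. inv\<^bsub>B\<^esub> (\<sigma> c)"
  have "?\<tau> \<in> carrier (crossed_homs C B \<eta>)"
    using \<sigma>
    by (subst crossed_homs_mem)
      (auto simp: crossed_hom_closed crossed_hom_mult act_inv B.inv_mult)
  moreover have "?\<tau> \<otimes>\<^bsub>crossed_homs C B \<eta>\<^esub> \<sigma> = \<one>\<^bsub>crossed_homs C B \<eta>\<^esub>"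
    unfolding crossed_homs_mult using crossed_hom_closed[OF \<sigma>]
    by (auto simp: crossed_homs_def intro!: restrict_ext)
  ultimately show "\<exists>\<tau>\<in>carrier (crossed_homs C B \<eta>).
      \<tau> \<otimes>\<^bsub>crossed_homs C B \<eta>\<^esub> \<sigma> = \<one>\<^bsub>crossed_homs C B \<eta>\<^esub>" by blast
next
  show "\<one>\<^bsub>crossed_homs C B \<eta>\<^esub> \<in> carrier (crossed_homs C B \<eta>)"
    by (auto simp: crossed_homs_mem crossed_homs_one act_unit)
qed (simp_all add: crossed_homs_mult crossed_homs_one crossed_hom_closed crossed_hom_restrict
    B.m_ac cong: restrict_cong)

end

section \<open>Extensions with abelian kernel\<close>

locale abelian_ext =
  fixes X :: "('b, 'e, 'c) group_ext"
  assumes abelian_extension: "abelian_extension X"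

sublocale abelian_ext \<subseteq> B: comm_group "Ker X"
  using abelian_extension by (simp add: abelian_extension_def)

sublocale abelian_ext \<subseteq> k: group_hom "Ker X" "Tot X" "incl X"
  using abelian_extension
  by (simp add: abelian_extension_def mon_def group_hom.intro group_hom_axioms.intro B.is_group)

sublocale abelian_ext \<subseteq> f: group_hom "Tot X" "Quo X" "prj X"
  using abelian_extension
  by (simp add: abelian_extension_def epi_def group_hom.intro group_hom_axioms.intro)

context abelian_ext
begin

lemma incl_eq_iff [simp]:
  "\<lbrakk>a \<in> carrier (Ker X); b \<in> carrier (Ker X)\<rbrakk> \<Longrightarrow> incl X a = incl X b \<longleftrightarrow> a = b"
  using abelian_extension by (auto simp: abelian_extension_def mon_def inj_on_def)

lemma incl_image_eq_kernel: "incl X ` carrier (Ker X) = kernel (Tot X) (Quo X) (prj X)"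
  using abelian_extension by (simp add: abelian_extension_def)

lemma prj_incl [simp]: "b \<in> carrier (Ker X) \<Longrightarrow> prj X (incl X b) = \<one>\<^bsub>Quo X\<^esub>"
  using incl_image_eq_kernel by (auto simp: kernel_def)

lemma prj_eq_one_obtain:
  assumes "e \<in> carrier (Tot X)" and "prj X e = \<one>\<^bsub>Quo X\<^esub>"
  obtains b where "b \<in> carrier (Ker X)" and "e = incl X b"
  using assms incl_image_eq_kernel by (auto simp: kernel_def)

text \<open>The quotient of two elements of a fibre lies in the kernel. All comparisons of two lifts
  of one element go through this.\<close>

lemma same_fibre_obtain:
  assumes "e \<in> carrier (Tot X)" and "e' \<in> carrier (Tot X)" and "prj X e' = prj X e"
  obtains b where "b \<in> carrier (Ker X)" and "e' = incl X b \<otimes>\<^bsub>Tot X\<^esub> e"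
proof (rule prj_eq_one_obtain)
  show "e' \<otimes>\<^bsub>Tot X\<^esub> inv\<^bsub>Tot X\<^esub> e \<in> carrier (Tot X)"
    and "prj X (e' \<otimes>\<^bsub>Tot X\<^esub> inv\<^bsub>Tot X\<^esub> e) = \<one>\<^bsub>Quo X\<^esub>"
    using assms by simp_all
next
  fix b assume "b \<in> carrier (Ker X)" "e' \<otimes>\<^bsub>Tot X\<^esub> inv\<^bsub>Tot X\<^esub> e = incl X b"
  then show thesis
    using assms that by (metis k.H.inv_solve_right' k.hom_closed)
qed

lemma prj_obtain:
  assumes "c \<in> carrier (Quo X)"
  obtains e where "e \<in> carrier (Tot X)" and "prj X e = c"
proof -
  have "c \<in> prj X ` carrier (Tot X)"
    using abelian_extension assms by (simp add: abelian_extension_def epi_def)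
  with that show thesis by blast
qed

text \<open>Freed of inverses, the conjugation equation can be checked by plain rewriting. It
  determines the value because another lift differs by a factor from the kernel, and the kernel,
  being abelian, acts trivially on itself by conjugation.\<close>

lemma induced_module_eqI:
  assumes e: "e \<in> carrier (Tot X)" and b: "b \<in> carrier (Ker X)" and b': "b' \<in> carrier (Ker X)"
    and eq: "incl X b' \<otimes>\<^bsub>Tot X\<^esub> e = e \<otimes>\<^bsub>Tot X\<^esub> incl X b"
  shows "induced_module X (prj X e) b = b'"
  unfolding induced_module_def
proof (rule the_equality)
  show "b' \<in> carrier (Ker X) \<and> (\<exists>e'\<in>carrier (Tot X). prj X e' = prj X e \<and>
      incl X b' = e' \<otimes>\<^bsub>Tot X\<^esub> incl X b \<otimes>\<^bsub>Tot X\<^esub> inv\<^bsub>Tot X\<^esub> e')"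
    using assms by (metis k.H.inv_solve_right k.H.m_closed k.hom_closed)
next
  fix a assume "a \<in> carrier (Ker X) \<and> (\<exists>e'\<in>carrier (Tot X). prj X e' = prj X e \<and>
      incl X a = e' \<otimes>\<^bsub>Tot X\<^esub> incl X b \<otimes>\<^bsub>Tot X\<^esub> inv\<^bsub>Tot X\<^esub> e')"
  then obtain e' where a: "a \<in> carrier (Ker X)" and e': "e' \<in> carrier (Tot X)"
    and "prj X e' = prj X e" and "incl X a = e' \<otimes>\<^bsub>Tot X\<^esub> incl X b \<otimes>\<^bsub>Tot X\<^esub> inv\<^bsub>Tot X\<^esub> e'"
    by blast
  then have eq': "incl X a \<otimes>\<^bsub>Tot X\<^esub> e' = e' \<otimes>\<^bsub>Tot X\<^esub> incl X b"
    using b by (simp add: k.H.m_assoc)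
  obtain d where d: "d \<in> carrier (Ker X)" "e' = incl X d \<otimes>\<^bsub>Tot X\<^esub> e"
    using same_fibre_obtain e e' \<open>prj X e' = prj X e\<close> .
  \<comment> \<open>Both sides equal \<open>e' \<otimes> incl X b\<close>: the left one by
    \<open>eq'\<close>, the right one by \<open>eq\<close> after splitting \<open>e'\<close> as
    \<open>incl X d \<otimes> e\<close>.\<close>
  have "incl X (a \<otimes>\<^bsub>Ker X\<^esub> d) \<otimes>\<^bsub>Tot X\<^esub> e = incl X (d \<otimes>\<^bsub>Ker X\<^esub> b') \<otimes>\<^bsub>Tot X\<^esub> e"
    using eq eq' e a b b' d by (simp add: k.H.m_assoc)
  then have "a \<otimes>\<^bsub>Ker X\<^esub> d = b' \<otimes>\<^bsub>Ker X\<^esub> d"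
    using e a b' d by (simp add: k.hom_mult[symmetric] B.m_comm del: k.hom_mult)
  then show "a = b'" using a b' d by simp
qed

text \<open>A conjugate of a kernel element lies over 1, hence in the image of
  \<open>incl X\<close>; so the description defining \<open>induced_module\<close> is
  satisfied.\<close>

lemma
  assumes e: "e \<in> carrier (Tot X)" and b: "b \<in> carrier (Ker X)"
  shows induced_module_closed: "induced_module X (prj X e) b \<in> carrier (Ker X)"
    and incl_induced_module:
      "incl X (induced_module X (prj X e) b) \<otimes>\<^bsub>Tot X\<^esub> e = e \<otimes>\<^bsub>Tot X\<^esub> incl X b"
proof -
  obtain b' where b': "b' \<in> carrier (Ker X)"
    and "e \<otimes>\<^bsub>Tot X\<^esub> incl X b \<otimes>\<^bsub>Tot X\<^esub> inv\<^bsub>Tot X\<^esub> e = incl X b'"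
    using e b by (auto intro: prj_eq_one_obtain[of "e \<otimes>\<^bsub>Tot X\<^esub> incl X b \<otimes>\<^bsub>Tot X\<^esub> inv\<^bsub>Tot X\<^esub> e"])
  then have eq: "incl X b' \<otimes>\<^bsub>Tot X\<^esub> e = e \<otimes>\<^bsub>Tot X\<^esub> incl X b"
    using e b by (metis k.H.inv_solve_right k.H.m_closed k.hom_closed)
  with induced_module_eqI[OF e b b'] b'
  show "induced_module X (prj X e) b \<in> carrier (Ker X)"
    and "incl X (induced_module X (prj X e) b) \<otimes>\<^bsub>Tot X\<^esub> e = e \<otimes>\<^bsub>Tot X\<^esub> incl X b"
    by simp_all
qed

text \<open>The commutation rule in front of a further factor, so that it still fires on products
  associated to the right.\<close>

lemma incl_induced_module_left:
  assumes "e \<in> carrier (Tot X)" and "b \<in> carrier (Ker X)" and "x \<in> carrier (Tot X)"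
  shows "incl X (induced_module X (prj X e) b) \<otimes>\<^bsub>Tot X\<^esub> (e \<otimes>\<^bsub>Tot X\<^esub> x)
    = e \<otimes>\<^bsub>Tot X\<^esub> (incl X b \<otimes>\<^bsub>Tot X\<^esub> x)"
  using assms incl_induced_module[OF assms(1,2)] induced_module_closed[OF assms(1,2)]
  by (simp flip: k.H.m_assoc)

text \<open>After choosing lifts, \<open>induced_module_eqI\<close> turns each law into an equation
  in \<open>Tot X\<close>. The product of lifts of \<open>c\<close> and \<open>d\<close> serves as
  the lift of their product.\<close>

lemma group_module_induced: "group_module (Quo X) (Ker X) (induced_module X)"
proof
  fix c assume "c \<in> carrier (Quo X)"
  then obtain e where e: "e \<in> carrier (Tot X)" "prj X e = c" by (rule prj_obtain)
  show "induced_module X c \<in> hom (Ker X) (Ker X)"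
  proof (rule homI)
    fix a b assume "a \<in> carrier (Ker X)" "b \<in> carrier (Ker X)"
    then show "induced_module X c (a \<otimes>\<^bsub>Ker X\<^esub> b) =
        induced_module X c a \<otimes>\<^bsub>Ker X\<^esub> induced_module X c b"
      using e by (auto intro!: induced_module_eqI simp: induced_module_closed k.H.m_assoc
          incl_induced_module incl_induced_module_left)
  qed (use e induced_module_closed in blast)
next
  fix b assume "b \<in> carrier (Ker X)"
  then show "induced_module X \<one>\<^bsub>Quo X\<^esub> b = b"
    using induced_module_eqI[of "\<one>\<^bsub>Tot X\<^esub>" b b] by simp
next
  fix c d b assume "c \<in> carrier (Quo X)" "d \<in> carrier (Quo X)" and b: "b \<in> carrier (Ker X)"
  then obtain e e' where e: "e \<in> carrier (Tot X)" "prj X e = c"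
    and e': "e' \<in> carrier (Tot X)" "prj X e' = d"
    by (metis prj_obtain)
  have "induced_module X (prj X (e \<otimes>\<^bsub>Tot X\<^esub> e')) b
      = induced_module X (prj X e) (induced_module X (prj X e') b)"
    using e(1) e'(1) b
    by (intro induced_module_eqI)
      (simp_all add: induced_module_closed k.H.m_assoc incl_induced_module incl_induced_module_left)
  then show "induced_module X (c \<otimes>\<^bsub>Quo X\<^esub> d) b = induced_module X c (induced_module X d b)"
    using e e' by simp
qed

end

text \<open>The inverse of the middle isomorphism again respects inclusions and projections. The
  range of \<open>incl X\<close> matters because \<open>inv_into\<close> cancels
  \<open>\<gamma>\<close> only on the carrier.\<close>

lemma ext_iso_sym:
  assumes "ext_iso X Y" and "group (Tot X)"
    and "incl X \<in> carrier (Ker X) \<rightarrow> carrier (Tot X)"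
  shows "ext_iso Y X"
proof -
  obtain \<gamma> where KQ: "Ker X = Ker Y" "Quo X = Quo Y"
    and iso: "\<gamma> \<in> iso (Tot X) (Tot Y)" and mor: "ext_morphism X Y (\<lambda>b. b) \<gamma> (\<lambda>c. c)"
    using assms(1) by (auto simp: ext_iso_def)
  let ?\<delta> = "inv_into (carrier (Tot X)) \<gamma>"
  have iso': "?\<delta> \<in> iso (Tot Y) (Tot X)"
    using group.iso_set_sym[OF assms(2) iso] .
  have bij: "bij_betw \<gamma> (carrier (Tot X)) (carrier (Tot Y))"
    using iso by (simp add: iso_def)
  have "?\<delta> (incl Y b) = incl X b" if "b \<in> carrier (Ker X)" for b
    using mor that assms(3) bij_betw_inv_into_left[OF bij, of "incl X b"]
    by (auto simp: ext_morphism_def)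
  moreover have "prj X (?\<delta> y) = prj Y y" if "y \<in> carrier (Tot Y)" for y
  proof -
    have "?\<delta> y \<in> carrier (Tot X)" using iso' that by (auto simp: iso_def hom_def)
    then show ?thesis
      using mor that bij_betw_inv_into_right[OF bij, of y] by (auto simp: ext_morphism_def)
  qed
  ultimately have "ext_morphism Y X (\<lambda>b. b) ?\<delta> (\<lambda>c. c)"
    using mor iso' KQ by (auto simp: ext_morphism_def iso_def hom_def)
  with iso' KQ show ?thesis by (auto simp: ext_iso_def)
qed

section \<open>Two extensions and a morphism between their modules\<close>

locale extension_module_morphism = X: abelian_ext X + Y: abelian_ext Y
  for X :: "('b, 'e, 'c) group_ext" and Y :: "('b2, 'e2, 'c2) group_ext" +
  fixes \<phi>0 :: "'c \<Rightarrow> 'c2" and \<phi>1 :: "'b \<Rightarrow> 'b2"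
  assumes module_morphism: "module_morphism (Quo X) (Ker X) (induced_module X)
           (Quo Y) (Ker Y) (induced_module Y) \<phi>0 \<phi>1"
begin

abbreviation "\<eta> \<equiv> pullback_module \<phi>0 (induced_module Y)"

end

sublocale extension_module_morphism \<subseteq> \<phi>0: group_hom "Quo X" "Quo Y" \<phi>0
  using module_morphism by unfold_locales (simp add: module_morphism_def)

sublocale extension_module_morphism \<subseteq> \<phi>1: group_hom "Ker X" "Ker Y" \<phi>1
  using module_morphism by unfold_locales (simp add: module_morphism_def)

sublocale extension_module_morphism \<subseteq> \<eta>: group_module "Quo X" "Ker Y" \<eta>
  by (rule group_module.pullback[OF Y.group_module_induced X.f.H.is_group \<phi>0.homh])

text \<open>This is the action in the semidirect product of which the push forward is a
  quotient.\<close>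

sublocale extension_module_morphism \<subseteq> \<eta>f: group_module "Tot X" "Ker Y" "\<lambda>e. \<eta> (prj X e)"
  using group_module.pullback[OF \<eta>.group_module_axioms X.k.H.is_group X.f.homh]
  by (simp add: pullback_module_def)

context extension_module_morphism
begin

lemma \<phi>1_induced_module:
  "\<lbrakk>e \<in> carrier (Tot X); b \<in> carrier (Ker X)\<rbrakk>
    \<Longrightarrow> \<phi>1 (induced_module X (prj X e) b) = \<eta> (prj X e) (\<phi>1 b)"
  using module_morphism by (simp add: module_morphism_def pullback_module_def)

lemma OPEXT_iff:
  "\<gamma> \<in> OPEXT \<phi>0 \<phi>1 X Y \<longleftrightarrow>
    \<gamma> \<in> extensional (carrier (Tot X)) \<and> \<gamma> \<in> hom (Tot X) (Tot Y) \<and>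
    (\<forall>b\<in>carrier (Ker X). \<gamma> (incl X b) = incl Y (\<phi>1 b)) \<and>
    (\<forall>e\<in>carrier (Tot X). prj Y (\<gamma> e) = \<phi>0 (prj X e))"
  by (simp add: OPEXT_def ext_morphism_def \<phi>0.homh \<phi>1.homh)

lemma OPEXT_closed: "\<lbrakk>\<gamma> \<in> OPEXT \<phi>0 \<phi>1 X Y; e \<in> carrier (Tot X)\<rbrakk> \<Longrightarrow> \<gamma> e \<in> carrier (Tot Y)"
  by (auto simp: OPEXT_iff hom_def)

lemma OPEXT_group_hom: "\<gamma> \<in> OPEXT \<phi>0 \<phi>1 X Y \<Longrightarrow> group_hom (Tot X) (Tot Y) \<gamma>"
  by unfold_locales (simp add: OPEXT_iff)

text \<open>\<open>\<gamma> e\<close> is a lift of \<open>\<phi>0 (prj X e)\<close>, so conjugation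
  by it is the action of \<open>prj X e\<close> through \<open>\<eta>\<close>.\<close>

lemma OPEXT_commute:
  assumes "\<gamma> \<in> OPEXT \<phi>0 \<phi>1 X Y" and e: "e \<in> carrier (Tot X)" and "b \<in> carrier (Ker Y)"
  shows "\<gamma> e \<otimes>\<^bsub>Tot Y\<^esub> incl Y b = incl Y (\<eta> (prj X e) b) \<otimes>\<^bsub>Tot Y\<^esub> \<gamma> e"
proof -
  have "prj Y (\<gamma> e) = \<phi>0 (prj X e)" using assms(1) e by (simp add: OPEXT_iff)
  then show ?thesis
    using Y.incl_induced_module[OF OPEXT_closed[OF assms(1) e] assms(3)]
    by (simp add: pullback_module_def)
qed

text \<open>Moving \<open>incl Y b'\<close> to the left of \<open>\<gamma> e\<close> produces the
  twist. With values of \<open>\<sigma>\<close> for \<open>b\<close> and \<open>b'\<close> the left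
  side matches the crossed homomorphism law; with arbitrary \<open>b\<close> and \<open>b'\<close>
  it matches the multiplication of the semidirect product.\<close>

lemma OPEXT_mult_twisted:
  assumes \<gamma>: "\<gamma> \<in> OPEXT \<phi>0 \<phi>1 X Y" and e: "e \<in> carrier (Tot X)" "e' \<in> carrier (Tot X)"
    and b: "b \<in> carrier (Ker Y)" "b' \<in> carrier (Ker Y)"
  shows "incl Y (b \<otimes>\<^bsub>Ker Y\<^esub> \<eta> (prj X e) b') \<otimes>\<^bsub>Tot Y\<^esub> \<gamma> (e \<otimes>\<^bsub>Tot X\<^esub> e')
    = (incl Y b \<otimes>\<^bsub>Tot Y\<^esub> \<gamma> e) \<otimes>\<^bsub>Tot Y\<^esub> (incl Y b' \<otimes>\<^bsub>Tot Y\<^esub> \<gamma> e')"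
proof -
  interpret \<gamma>: group_hom "Tot X" "Tot Y" \<gamma> using \<gamma> by (rule OPEXT_group_hom)
  have "incl Y (\<eta> (prj X e) b') \<otimes>\<^bsub>Tot Y\<^esub> (\<gamma> e \<otimes>\<^bsub>Tot Y\<^esub> \<gamma> e')
      = \<gamma> e \<otimes>\<^bsub>Tot Y\<^esub> (incl Y b' \<otimes>\<^bsub>Tot Y\<^esub> \<gamma> e')"
    using OPEXT_commute[OF \<gamma> e(1) b(2)] e b by (simp flip: Y.k.H.m_assoc)
  then show ?thesis using e b by (simp add: Y.k.H.m_assoc)
qed

section \<open>The action of crossed homomorphisms\<close>

abbreviation "Z1 \<equiv> crossed_homs (Quo X) (Ker Y) \<eta>"

text \<open>Multiplicativity is the crossed homomorphism law read through
  \<open>OPEXT_mult_twisted\<close>. On the kernel the new factor is \<open>incl Y\<close> of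
  \<open>\<sigma>\<close> at 1, which is trivial, and everywhere it lies over 1, so the induced pair
  is unchanged.\<close>

lemma OPEXT_twist:
  assumes \<sigma>: "\<sigma> \<in> carrier Z1" and \<gamma>: "\<gamma> \<in> OPEXT \<phi>0 \<phi>1 X Y"
  shows "(\<lambda>e\<in>carrier (Tot X). incl Y (\<sigma> (prj X e)) \<otimes>\<^bsub>Tot Y\<^esub> \<gamma> e) \<in> OPEXT \<phi>0 \<phi>1 X Y"
proof -
  have "(\<lambda>e\<in>carrier (Tot X). incl Y (\<sigma> (prj X e)) \<otimes>\<^bsub>Tot Y\<^esub> \<gamma> e) \<in> hom (Tot X) (Tot Y)"
    using OPEXT_mult_twisted[OF \<gamma>]
    by (intro homI)
      (simp_all add: \<eta>.crossed_hom_closed[OF \<sigma>] \<eta>.crossed_hom_mult[OF \<sigma>] OPEXT_closed[OF \<gamma>])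
  with \<gamma> show ?thesis
    unfolding OPEXT_iff
    by (simp add: \<eta>.crossed_hom_closed[OF \<sigma>] \<eta>.crossed_hom_one[OF \<sigma>] OPEXT_closed[OF \<gamma>])
qed

lemma OPEXT_action_apply:
  assumes "\<gamma> \<in> OPEXT \<phi>0 \<phi>1 X Y"
  shows "OPEXT_action \<phi>0 \<phi>1 X Y \<sigma> \<gamma> =
    (\<lambda>e\<in>carrier (Tot X). incl Y (\<sigma> (prj X e)) \<otimes>\<^bsub>Tot Y\<^esub> \<gamma> e)"
  using assms by (simp add: OPEXT_action_def)

lemma OPEXT_action_closed:
  "\<lbrakk>\<sigma> \<in> carrier Z1; \<gamma> \<in> OPEXT \<phi>0 \<phi>1 X Y\<rbrakk> \<Longrightarrow> OPEXT_action \<phi>0 \<phi>1 X Y \<sigma> \<gamma> \<in> OPEXT \<phi>0 \<phi>1 X Y"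
  by (simp add: OPEXT_action_apply OPEXT_twist)

lemma OPEXT_action_one:
  assumes "\<gamma> \<in> OPEXT \<phi>0 \<phi>1 X Y"
  shows "OPEXT_action \<phi>0 \<phi>1 X Y \<one>\<^bsub>Z1\<^esub> \<gamma> = \<gamma>"
proof (rule extensionalityI)
  show "OPEXT_action \<phi>0 \<phi>1 X Y \<one>\<^bsub>Z1\<^esub> \<gamma> \<in> extensional (carrier (Tot X))"
    using assms by (simp add: OPEXT_action_apply)
qed (use assms in \<open>auto simp: OPEXT_action_apply OPEXT_iff crossed_homs_def OPEXT_closed\<close>)

lemma OPEXT_action_mult:
  assumes \<sigma>: "\<sigma> \<in> carrier Z1" and \<tau>: "\<tau> \<in> carrier Z1" and \<gamma>: "\<gamma> \<in> OPEXT \<phi>0 \<phi>1 X Y"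
  shows "OPEXT_action \<phi>0 \<phi>1 X Y (\<sigma> \<otimes>\<^bsub>Z1\<^esub> \<tau>) \<gamma> =
    OPEXT_action \<phi>0 \<phi>1 X Y \<sigma> (OPEXT_action \<phi>0 \<phi>1 X Y \<tau> \<gamma>)"
  unfolding OPEXT_action_apply[OF \<gamma>] OPEXT_action_apply[OF OPEXT_twist[OF \<tau> \<gamma>]]
  by (intro restrict_ext)
    (simp add: \<eta>.crossed_homs_mult \<eta>.crossed_hom_closed[OF \<sigma>] \<eta>.crossed_hom_closed[OF \<tau>]
      OPEXT_closed[OF \<gamma>] Y.k.H.m_assoc)

text \<open>Acting by \<open>\<sigma>\<close> is inverted by acting by its inverse in
  \<open>Z1\<close>. Since \<open>OPEXT_action\<close> is restricted to the set acted on, its values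
  lie in \<open>Bij\<close>, and the homomorphism law is an equality with
  \<open>compose\<close>.\<close>

lemma group_action_OPEXT: "group_action Z1 (OPEXT \<phi>0 \<phi>1 X Y) (OPEXT_action \<phi>0 \<phi>1 X Y)"
proof -
  interpret Z1: comm_group Z1 by (rule \<eta>.comm_group_crossed_homs)
  have Bij: "OPEXT_action \<phi>0 \<phi>1 X Y \<sigma> \<in> Bij (OPEXT \<phi>0 \<phi>1 X Y)" if \<sigma>: "\<sigma> \<in> carrier Z1" for \<sigma>
  proof -
    have "bij_betw (OPEXT_action \<phi>0 \<phi>1 X Y \<sigma>) (OPEXT \<phi>0 \<phi>1 X Y) (OPEXT \<phi>0 \<phi>1 X Y)"
      by (rule bij_betw_byWitness[where f' = "OPEXT_action \<phi>0 \<phi>1 X Y (inv\<^bsub>Z1\<^esub> \<sigma>)"])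
        (use \<sigma> in \<open>auto simp: OPEXT_action_closed OPEXT_action_one Z1.l_inv Z1.r_inv
            simp flip: OPEXT_action_mult\<close>)
    then show ?thesis by (simp add: Bij_def OPEXT_action_def)
  qed
  have "OPEXT_action \<phi>0 \<phi>1 X Y \<in> hom Z1 (BijGroup (OPEXT \<phi>0 \<phi>1 X Y))"
  proof (rule homI)
    fix \<sigma> \<tau> assume \<sigma>: "\<sigma> \<in> carrier Z1" and \<tau>: "\<tau> \<in> carrier Z1"
    have "OPEXT_action \<phi>0 \<phi>1 X Y (\<sigma> \<otimes>\<^bsub>Z1\<^esub> \<tau>) =
        compose (OPEXT \<phi>0 \<phi>1 X Y) (OPEXT_action \<phi>0 \<phi>1 X Y \<sigma>) (OPEXT_action \<phi>0 \<phi>1 X Y \<tau>)"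
      using OPEXT_action_mult[OF \<sigma> \<tau>]
      by (intro extensionalityI[where A = "OPEXT \<phi>0 \<phi>1 X Y"])
        (auto simp: OPEXT_action_def[of _ _ _ _ "\<sigma> \<otimes>\<^bsub>Z1\<^esub> \<tau>"] compose_eq)
    then show "OPEXT_action \<phi>0 \<phi>1 X Y (\<sigma> \<otimes>\<^bsub>Z1\<^esub> \<tau>) =
        OPEXT_action \<phi>0 \<phi>1 X Y \<sigma> \<otimes>\<^bsub>BijGroup (OPEXT \<phi>0 \<phi>1 X Y)\<^esub> OPEXT_action \<phi>0 \<phi>1 X Y \<tau>"
      using \<sigma> \<tau> Bij by (simp add: BijGroup_def)
  qed (use Bij in \<open>simp add: BijGroup_def\<close>)
  then show ?thesis
    by (intro group_action.intro group_hom.intro group_hom_axioms.intro Z1.is_group group_BijGroup)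
qed

lemma OPEXT_difference:
  assumes \<gamma>: "\<gamma> \<in> OPEXT \<phi>0 \<phi>1 X Y" and \<delta>: "\<delta> \<in> OPEXT \<phi>0 \<phi>1 X Y"
  obtains \<sigma> where "\<sigma> \<in> carrier Z1" and "OPEXT_action \<phi>0 \<phi>1 X Y \<sigma> \<gamma> = \<delta>"
proof -
  interpret \<gamma>: group_hom "Tot X" "Tot Y" \<gamma> using \<gamma> by (rule OPEXT_group_hom)
  interpret \<delta>: group_hom "Tot X" "Tot Y" \<delta> using \<delta> by (rule OPEXT_group_hom)
  \<comment> \<open>A section of \<open>prj X\<close> as a map of sets, used to read off
    \<open>\<sigma>\<close> at one lift of each element.\<close>
  define s where "s c = (SOME e. e \<in> carrier (Tot X) \<and> prj X e = c)" for c
  have s: "s c \<in> carrier (Tot X)" "prj X (s c) = c" if c: "c \<in> carrier (Quo X)" for c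
  proof -
    have "\<exists>e. e \<in> carrier (Tot X) \<and> prj X e = c" using X.prj_obtain[OF c] by metis
    from someI_ex[OF this] show "s c \<in> carrier (Tot X)" "prj X (s c) = c" by (simp_all add: s_def)
  qed
  have "\<exists>b. b \<in> carrier (Ker Y) \<and> \<delta> (s c) = incl Y b \<otimes>\<^bsub>Tot Y\<^esub> \<gamma> (s c)"
    if c: "c \<in> carrier (Quo X)" for c
  proof -
    have "prj Y (\<delta> (s c)) = prj Y (\<gamma> (s c))" using \<gamma> \<delta> s[OF c] by (simp add: OPEXT_iff)
    then show ?thesis
      using Y.same_fibre_obtain[OF \<gamma>.hom_closed \<delta>.hom_closed, of "s c" "s c"] s[OF c] by metis
  qed
  then obtain \<rho> where \<rho>: "\<And>c. c \<in> carrier (Quo X) \<Longrightarrow>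
      \<rho> c \<in> carrier (Ker Y) \<and> \<delta> (s c) = incl Y (\<rho> c) \<otimes>\<^bsub>Tot Y\<^esub> \<gamma> (s c)"
    by metis
  define \<sigma> where "\<sigma> = restrict \<rho> (carrier (Quo X))"
  have cl: "\<sigma> c \<in> carrier (Ker Y)" if "c \<in> carrier (Quo X)" for c
    using \<rho> that by (simp add: \<sigma>_def)
  \<comment> \<open>The relation passes from the chosen lift to every other one: translating by
    \<open>incl X b\<close> multiplies both \<open>\<gamma>\<close> and \<open>\<delta>\<close> by
    \<open>incl Y (\<phi>1 b)\<close>, which commutes with the values of \<open>\<sigma>\<close> in
    \<open>Y\<close>.\<close>
  have eq: "\<delta> e = incl Y (\<sigma> (prj X e)) \<otimes>\<^bsub>Tot Y\<^esub> \<gamma> e" if e: "e \<in> carrier (Tot X)" for e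
  proof -
    let ?e = "s (prj X e)"
    have se: "?e \<in> carrier (Tot X)" "prj X ?e = prj X e" using s e by simp_all
    obtain b where b: "b \<in> carrier (Ker X)" "e = incl X b \<otimes>\<^bsub>Tot X\<^esub> ?e"
      using X.same_fibre_obtain[OF se(1) e se(2)[symmetric]] .
    have "\<delta> e = incl Y (\<phi>1 b) \<otimes>\<^bsub>Tot Y\<^esub> \<delta> ?e"
      using \<delta> b se by (metis OPEXT_iff X.k.hom_closed \<delta>.hom_mult)
    also have "\<dots> = incl Y (\<phi>1 b) \<otimes>\<^bsub>Tot Y\<^esub> (incl Y (\<sigma> (prj X e)) \<otimes>\<^bsub>Tot Y\<^esub> \<gamma> ?e)"
      using \<rho>[of "prj X e"] e by (simp add: \<sigma>_def)
    also have "\<dots> = incl Y (\<phi>1 b \<otimes>\<^bsub>Ker Y\<^esub> \<sigma> (prj X e)) \<otimes>\<^bsub>Tot Y\<^esub> \<gamma> ?e"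
      using cl b e se by (simp add: Y.k.H.m_assoc)
    also have "\<dots> = incl Y (\<sigma> (prj X e)) \<otimes>\<^bsub>Tot Y\<^esub> (incl Y (\<phi>1 b) \<otimes>\<^bsub>Tot Y\<^esub> \<gamma> ?e)"
      using cl b e se by (simp add: Y.k.H.m_assoc Y.B.m_comm[of "\<phi>1 b"])
    also have "incl Y (\<phi>1 b) \<otimes>\<^bsub>Tot Y\<^esub> \<gamma> ?e = \<gamma> e"
      using \<gamma> b se by (metis OPEXT_iff X.k.hom_closed \<gamma>.hom_mult)
    finally show ?thesis .
  qed
  have "\<sigma> (c \<otimes>\<^bsub>Quo X\<^esub> d) = \<sigma> c \<otimes>\<^bsub>Ker Y\<^esub> \<eta> c (\<sigma> d)"
    if c: "c \<in> carrier (Quo X)" and d: "d \<in> carrier (Quo X)" for c d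
  proof -
    \<comment> \<open>The product of \<open>s c\<close> and \<open>s d\<close> need not be the
      chosen lift of the product, but \<open>eq\<close> holds at every lift.\<close>
    have "incl Y (\<sigma> (c \<otimes>\<^bsub>Quo X\<^esub> d)) \<otimes>\<^bsub>Tot Y\<^esub> \<gamma> (s c \<otimes>\<^bsub>Tot X\<^esub> s d) = \<delta> (s c \<otimes>\<^bsub>Tot X\<^esub> s d)"
      using eq[of "s c \<otimes>\<^bsub>Tot X\<^esub> s d"] s c d by simp
    also have "\<dots> = (incl Y (\<sigma> c) \<otimes>\<^bsub>Tot Y\<^esub> \<gamma> (s c)) \<otimes>\<^bsub>Tot Y\<^esub> (incl Y (\<sigma> d) \<otimes>\<^bsub>Tot Y\<^esub> \<gamma> (s d))"
      using eq[of "s c"] eq[of "s d"] s c d by simp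
    also have "\<dots> = incl Y (\<sigma> c \<otimes>\<^bsub>Ker Y\<^esub> \<eta> c (\<sigma> d)) \<otimes>\<^bsub>Tot Y\<^esub> \<gamma> (s c \<otimes>\<^bsub>Tot X\<^esub> s d)"
      using OPEXT_mult_twisted[OF \<gamma>, of "s c" "s d" "\<sigma> c" "\<sigma> d"] s c d cl by simp
    \<comment> \<open>The common right factor cancels as long as \<open>\<gamma>\<close> and
      \<open>incl Y\<close> are not expanded over products.\<close>
    finally have "incl Y (\<sigma> (c \<otimes>\<^bsub>Quo X\<^esub> d)) = incl Y (\<sigma> c \<otimes>\<^bsub>Ker Y\<^esub> \<eta> c (\<sigma> d))"
      using s c d cl by (simp del: Y.k.hom_mult \<gamma>.hom_mult)
    then show ?thesis using c d cl by (simp del: Y.k.hom_mult)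
  qed
  then have "\<sigma> \<in> carrier Z1" using cl by (auto simp: \<eta>.crossed_homs_mem \<sigma>_def)
  moreover have "OPEXT_action \<phi>0 \<phi>1 X Y \<sigma> \<gamma> = \<delta>"
    unfolding OPEXT_action_apply[OF \<gamma>]
    by (rule extensionalityI[where A = "carrier (Tot X)"]) (use \<delta> eq in \<open>auto simp: OPEXT_iff\<close>)
  ultimately show thesis ..
qed

text \<open>Every \<open>c\<close> is of the form \<open>prj X e\<close>; there
  \<open>\<gamma> e\<close> cancels and \<open>incl Y\<close> is injective.\<close>

lemma OPEXT_action_free:
  assumes \<sigma>: "\<sigma> \<in> carrier Z1" and \<tau>: "\<tau> \<in> carrier Z1" and \<gamma>: "\<gamma> \<in> OPEXT \<phi>0 \<phi>1 X Y"
    and eq: "OPEXT_action \<phi>0 \<phi>1 X Y \<sigma> \<gamma> = OPEXT_action \<phi>0 \<phi>1 X Y \<tau> \<gamma>"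
  shows "\<sigma> = \<tau>"
proof (rule extensionalityI)
  show "\<sigma> \<in> extensional (carrier (Quo X))" "\<tau> \<in> extensional (carrier (Quo X))"
    using \<sigma> \<tau> by (simp_all add: \<eta>.crossed_homs_mem PiE_def)
  fix c assume c: "c \<in> carrier (Quo X)"
  then obtain e where e: "e \<in> carrier (Tot X)" "prj X e = c" by (rule X.prj_obtain)
  then have "incl Y (\<sigma> c) \<otimes>\<^bsub>Tot Y\<^esub> \<gamma> e = incl Y (\<tau> c) \<otimes>\<^bsub>Tot Y\<^esub> \<gamma> e"
    using fun_cong[OF eq, of e] by (simp add: OPEXT_action_apply[OF \<gamma>])
  then show "\<sigma> c = \<tau> c"
    using c e by (simp add: \<eta>.crossed_hom_closed[OF \<sigma>] \<eta>.crossed_hom_closed[OF \<tau>] OPEXT_closed[OF \<gamma>])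
qed

lemma simply_transitive_OPEXT:
  "simply_transitive_action Z1 (OPEXT \<phi>0 \<phi>1 X Y) (OPEXT_action \<phi>0 \<phi>1 X Y)"
proof (intro simply_transitive_action.intro simply_transitive_action_axioms.intro group_action_OPEXT)
  fix \<gamma> \<delta> assume "\<gamma> \<in> OPEXT \<phi>0 \<phi>1 X Y" "\<delta> \<in> OPEXT \<phi>0 \<phi>1 X Y"
  then show "\<exists>!\<sigma>. \<sigma> \<in> carrier Z1 \<and> OPEXT_action \<phi>0 \<phi>1 X Y \<sigma> \<gamma> = \<delta>"
    by (metis OPEXT_difference OPEXT_action_free)
qed

section \<open>Pullback and push forward\<close>

abbreviation "S \<equiv> semidirect (Ker Y) (Tot X) (\<lambda>e. \<eta> (prj X e))"
abbreviation "N \<equiv> {(inv\<^bsub>Ker Y\<^esub> (\<phi>1 b), incl X b) | b. b \<in> carrier (Ker X)}"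
abbreviation "PB \<equiv> pullback_ext (Quo X) \<phi>0 Y"
abbreviation "PF \<equiv> pushforward_ext (Ker Y) \<eta> \<phi>1 X"

section \<open>The push forward as a quotient of the semidirect product\<close>

lemma pushforward_simps:
  "Ker PF = Ker Y" "Tot PF = S Mod N" "Quo PF = Quo X"
  "incl PF b' = N #>\<^bsub>S\<^esub> (b', \<one>\<^bsub>Tot X\<^esub>)"
  "prj PF A = the_elem ((\<lambda>(b', e). prj X e) ` A)"
  by (simp_all add: pushforward_ext_def Let_def)

lemma semidirect_simps:
  "carrier S = carrier (Ker Y) \<times> carrier (Tot X)"
  "(b, e) \<otimes>\<^bsub>S\<^esub> (b', e') = (b \<otimes>\<^bsub>Ker Y\<^esub> \<eta> (prj X e) b', e \<otimes>\<^bsub>Tot X\<^esub> e')"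
  "\<one>\<^bsub>S\<^esub> = (\<one>\<^bsub>Ker Y\<^esub>, \<one>\<^bsub>Tot X\<^esub>)"
  by (simp_all add: semidirect_def)

text \<open>\<open>incl X b\<close> lies over 1 and so acts trivially; hence \<open>?n\<close> is a
  homomorphism and its image \<open>N\<close> a subgroup. Normality is the equivariance of
  \<open>\<phi>1\<close>.\<close>

lemma normal_pushforward: "N \<lhd> S"
proof -
  interpret S: group S by (rule \<eta>f.group_semidirect)
  let ?n = "\<lambda>b. (inv\<^bsub>Ker Y\<^esub> (\<phi>1 b), incl X b)"
  have hom: "?n \<in> hom (Ker X) S"
    by (rule homI) (auto simp: semidirect_simps \<eta>.act_one Y.B.inv_mult)
  interpret n: group_hom "Ker X" S ?n
    using hom by unfold_locales
  have N: "N = ?n ` carrier (Ker X)" by auto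
  have "subgroup N S" unfolding N by (rule n.img_is_subgroup)
  moreover have "x \<otimes>\<^bsub>S\<^esub> h \<otimes>\<^bsub>S\<^esub> inv\<^bsub>S\<^esub> x \<in> N" if x: "x \<in> carrier S" and h: "h \<in> N" for x h
  proof -
    obtain b where b: "b \<in> carrier (Ker X)" "h = ?n b" using h by blast
    obtain y e where ye: "x = (y, e)" "y \<in> carrier (Ker Y)" "e \<in> carrier (Tot X)"
      using x by (auto simp: semidirect_simps)
    let ?b = "induced_module X (prj X e) b"
    have "?b \<in> carrier (Ker X)" using ye b by (simp add: X.induced_module_closed)
    \<comment> \<open>Conjugation by \<open>x\<close> sends \<open>?n b\<close> to
      \<open>?n ?b\<close>. In the first components, equivariance rewrites
      \<open>\<phi>1 ?b\<close>, and \<open>y\<close> changes sides by commutativity of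
      \<open>Ker Y\<close>.\<close>
    moreover have "x \<otimes>\<^bsub>S\<^esub> h = ?n ?b \<otimes>\<^bsub>S\<^esub> x"
      using b ye calculation
      by (simp add: semidirect_simps X.incl_induced_module \<phi>1_induced_module \<eta>.act_inv \<eta>.act_one
          Y.B.m_comm)
    ultimately show ?thesis
      using x n.hom_closed by (auto simp: S.m_assoc)
  qed
  ultimately show ?thesis by (simp add: S.normal_inv_iff)
qed

text \<open>Elements of \<open>N\<close> have second component over 1, so the projection is constant
  on a coset and \<open>the_elem\<close> is applied to a singleton.\<close>

lemma prj_pushforward:
  assumes "y \<in> carrier (Ker Y)" and "e \<in> carrier (Tot X)"
  shows "prj PF (N #>\<^bsub>S\<^esub> (y, e)) = prj X e"
proof -
  interpret N: normal N S by (rule normal_pushforward)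
  have "(y, e) \<in> N #>\<^bsub>S\<^esub> (y, e)"
    using assms by (intro N.rcos_self N.is_subgroup) (simp add: semidirect_simps)
  moreover have "(case x of (b', e') \<Rightarrow> prj X e') = prj X e" if "x \<in> N #>\<^bsub>S\<^esub> (y, e)" for x
  proof -
    obtain b where "b \<in> carrier (Ker X)" "x = (inv\<^bsub>Ker Y\<^esub> (\<phi>1 b), incl X b) \<otimes>\<^bsub>S\<^esub> (y, e)"
      using \<open>x \<in> N #>\<^bsub>S\<^esub> (y, e)\<close> unfolding r_coset_def by blast
    with assms show ?thesis by (simp add: semidirect_simps)
  qed
  ultimately show ?thesis
    unfolding pushforward_simps by (intro the_elem_image_unique) blast+
qed

section \<open>The pullback extension\<close>

lemma pullback_simps:
  "Ker PB = Ker Y" "Quo PB = Quo X"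
  "carrier (Tot PB) = {(e, c). e \<in> carrier (Tot Y) \<and> c \<in> carrier (Quo X) \<and> prj Y e = \<phi>0 c}"
  "(e, c) \<otimes>\<^bsub>Tot PB\<^esub> (e', c') = (e \<otimes>\<^bsub>Tot Y\<^esub> e', c \<otimes>\<^bsub>Quo X\<^esub> c')"
  "\<one>\<^bsub>Tot PB\<^esub> = (\<one>\<^bsub>Tot Y\<^esub>, \<one>\<^bsub>Quo X\<^esub>)"
  "incl PB b = (incl Y b, \<one>\<^bsub>Quo X\<^esub>)" "prj PB = snd"
  by (simp_all add: pullback_ext_def DirProd_def)

lemma group_pullback: "group (Tot PB)"
proof (rule groupI)
  fix x assume "x \<in> carrier (Tot PB)"
  then show "\<exists>y\<in>carrier (Tot PB). y \<otimes>\<^bsub>Tot PB\<^esub> x = \<one>\<^bsub>Tot PB\<^esub>"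
    by (intro bexI[where x = "(inv\<^bsub>Tot Y\<^esub> (fst x), inv\<^bsub>Quo X\<^esub> (snd x))"])
      (auto simp: pullback_simps)
qed (auto simp: pullback_simps Y.k.H.m_assoc X.f.H.m_assoc)

lemma incl_pullback_closed: "incl PB \<in> carrier (Ker PB) \<rightarrow> carrier (Tot PB)"
  by (auto simp: pullback_simps)

section \<open>Comparison of the push forward with the pullback\<close>

lemma ext_iso_of_OPEXT:
  assumes \<gamma>: "\<gamma> \<in> OPEXT \<phi>0 \<phi>1 X Y"
  shows "ext_iso PF PB"
proof -
  interpret \<gamma>: group_hom "Tot X" "Tot Y" \<gamma> using \<gamma> by (rule OPEXT_group_hom)
  have prj: "prj Y (\<gamma> e) = \<phi>0 (prj X e)" if "e \<in> carrier (Tot X)" for e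
    using \<gamma> that by (simp add: OPEXT_iff)
  have incl: "\<gamma> (incl X b) = incl Y (\<phi>1 b)" if "b \<in> carrier (Ker X)" for b
    using \<gamma> that by (simp add: OPEXT_iff)
  define \<theta> where "\<theta> = (\<lambda>(y, e). (incl Y y \<otimes>\<^bsub>Tot Y\<^esub> \<gamma> e, prj X e))"
  \<comment> \<open>In the first component multiplicativity is \<open>OPEXT_mult_twisted\<close>,
    whose left side has to be met unexpanded.\<close>
  have "\<theta> \<in> hom S (Tot PB)"
    by (rule homI)
      (auto simp: \<theta>_def semidirect_simps pullback_simps prj OPEXT_mult_twisted[OF \<gamma>]
        simp del: \<gamma>.hom_mult Y.k.hom_mult)
  then interpret \<theta>: group_hom S "Tot PB" \<theta>
    by (intro group_hom.intro group_hom_axioms.intro \<eta>f.group_semidirect group_pullback)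
  \<comment> \<open>For \<open>(u, c)\<close> in the pullback and a lift \<open>e\<close> of
    \<open>c\<close>, the elements \<open>u\<close> and \<open>\<gamma> e\<close> lie in one fibre
    of \<open>prj Y\<close>; their difference is the required \<open>y\<close>.\<close>
  have surj: "\<theta> ` carrier S = carrier (Tot PB)"
  proof (intro equalityI subsetI)
    fix z assume "z \<in> carrier (Tot PB)"
    then obtain u c where z: "z = (u, c)" "u \<in> carrier (Tot Y)" "c \<in> carrier (Quo X)" "prj Y u = \<phi>0 c"
      by (auto simp: pullback_simps)
    obtain e where e: "e \<in> carrier (Tot X)" "prj X e = c" using z(3) by (rule X.prj_obtain)
    have "prj Y u = prj Y (\<gamma> e)" using z e prj by simp
    then obtain y where "y \<in> carrier (Ker Y)" "u = incl Y y \<otimes>\<^bsub>Tot Y\<^esub> \<gamma> e"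
      using Y.same_fibre_obtain[of "\<gamma> e" u] z e by auto
    with z e have "z = \<theta> (y, e)" "(y, e) \<in> carrier S" by (auto simp: \<theta>_def semidirect_simps)
    then show "z \<in> \<theta> ` carrier S" by blast
  qed auto
  have ker: "kernel S (Tot PB) \<theta> = N"
  proof (intro equalityI subsetI)
    fix x assume "x \<in> kernel S (Tot PB) \<theta>"
    then obtain y e where x: "x = (y, e)" "y \<in> carrier (Ker Y)" "e \<in> carrier (Tot X)"
      and "prj X e = \<one>\<^bsub>Quo X\<^esub>" and one: "incl Y y \<otimes>\<^bsub>Tot Y\<^esub> \<gamma> e = \<one>\<^bsub>Tot Y\<^esub>"
      by (auto simp: kernel_def semidirect_simps \<theta>_def pullback_simps)
    then obtain b where b: "b \<in> carrier (Ker X)" "e = incl X b" by (metis X.prj_eq_one_obtain)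
    \<comment> \<open>With \<open>e = incl X b\<close> the factor \<open>\<gamma> e\<close> is
      \<open>incl Y (\<phi>1 b)\<close>, so \<open>one\<close> becomes an equation inside
      \<open>Ker Y\<close>.\<close>
    have "incl Y (y \<otimes>\<^bsub>Ker Y\<^esub> \<phi>1 b) = incl Y \<one>\<^bsub>Ker Y\<^esub>" using one x b incl by simp
    then have "y \<otimes>\<^bsub>Ker Y\<^esub> \<phi>1 b = \<one>\<^bsub>Ker Y\<^esub>" using x b by (simp del: Y.k.hom_mult Y.k.hom_one)
    then have "y = inv\<^bsub>Ker Y\<^esub> (\<phi>1 b)" using x b by (metis Y.B.inv_equality \<phi>1.hom_closed Y.B.inv_inv Y.B.inv_comm)
    with x b show "x \<in> N" by blast
  qed (auto simp: kernel_def semidirect_simps \<theta>_def pullback_simps incl)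
  \<comment> \<open>The isomorphism induced by \<open>\<theta>\<close> on the quotient, in the form
    in which \<open>FactGroup_iso_set\<close> provides it.\<close>
  define \<Theta> where "\<Theta> = (\<lambda>A. the_elem (\<theta> ` A))"
  have iso: "\<Theta> \<in> iso (Tot PF) (Tot PB)"
    using \<theta>.FactGroup_iso_set[OF surj] by (simp add: ker \<Theta>_def pushforward_simps)
  have \<Theta>: "\<Theta> (N #>\<^bsub>S\<^esub> (y, e)) = \<theta> (y, e)"
    if "y \<in> carrier (Ker Y)" "e \<in> carrier (Tot X)" for y e
  proof -
    have ye: "(y, e) \<in> carrier S" using that by (simp add: semidirect_simps)
    have "the_elem (\<theta> ` (kernel S (Tot PB) \<theta> #>\<^bsub>S\<^esub> (y, e))) = \<theta> (y, e)"
    proof (rule the_elem_image_unique)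
      show "kernel S (Tot PB) \<theta> #>\<^bsub>S\<^esub> (y, e) \<noteq> {}"
        using \<theta>.G.rcos_self[OF ye \<theta>.subgroup_kernel] by blast
      fix x assume "x \<in> kernel S (Tot PB) \<theta> #>\<^bsub>S\<^esub> (y, e)"
      then obtain n where "n \<in> kernel S (Tot PB) \<theta>" "x = n \<otimes>\<^bsub>S\<^esub> (y, e)"
        unfolding r_coset_def by blast
      with ye show "\<theta> x = \<theta> (y, e)" by (simp add: kernel_def)
    qed
    then show ?thesis by (simp add: ker \<Theta>_def)
  qed
  have "prj PB (\<Theta> A) = prj PF A" if A: "A \<in> carrier (Tot PF)" for A
  proof -
    obtain y e where "A = N #>\<^bsub>S\<^esub> (y, e)" "y \<in> carrier (Ker Y)" "e \<in> carrier (Tot X)"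
      using A by (auto simp: pushforward_simps FactGroup_def RCOSETS_def semidirect_simps)
    then show ?thesis using \<Theta> prj_pushforward by (simp add: \<theta>_def pullback_simps)
  qed
  moreover have "\<Theta> (incl PF b) = incl PB b" if "b \<in> carrier (Ker Y)" for b
    using that \<Theta> by (simp add: pushforward_simps pullback_simps \<theta>_def)
  ultimately have "ext_morphism PF PB (\<lambda>b. b) \<Theta> (\<lambda>c. c)"
    using iso by (simp add: ext_morphism_def pushforward_simps pullback_simps iso_def hom_def)
  with iso show ?thesis by (auto simp: ext_iso_def pushforward_simps pullback_simps)
qed

lemma OPEXT_nonempty_of_morphism:
  assumes "ext_morphism PF PB (\<lambda>b. b) \<psi> (\<lambda>c. c)"
  shows "OPEXT \<phi>0 \<phi>1 X Y \<noteq> {}"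
proof -
  interpret N: normal N S by (rule normal_pushforward)
  have \<psi>: "\<psi> \<in> hom (S Mod N) (Tot PB)"
    and incl: "\<And>b. b \<in> carrier (Ker Y) \<Longrightarrow> \<psi> (N #>\<^bsub>S\<^esub> (b, \<one>\<^bsub>Tot X\<^esub>)) = (incl Y b, \<one>\<^bsub>Quo X\<^esub>)"
    and prj: "\<And>A. A \<in> carrier (S Mod N) \<Longrightarrow> snd (\<psi> A) = prj PF A"
    using assms by (simp_all add: ext_morphism_def pushforward_simps(1-4) pullback_simps)
  \<comment> \<open>The canonical morphism from \<open>X\<close> to its push forward, the
    opcartesian lifting of \<open>\<phi>1\<close>.\<close>
  define j where "j = (\<lambda>e. N #>\<^bsub>S\<^esub> (\<one>\<^bsub>Ker Y\<^esub>, e))"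
  have "(\<lambda>e. (\<one>\<^bsub>Ker Y\<^esub>, e)) \<in> hom (Tot X) S"
    by (rule homI) (auto simp: semidirect_simps \<eta>.act_unit)
  from hom_compose[OF this N.r_coset_hom_Mod] have j: "j \<in> hom (Tot X) (S Mod N)"
    by (simp add: j_def o_def)
  have "fst \<in> hom (Tot PB) (Tot Y)" by (rule homI) (auto simp: pullback_simps)
  then have hom: "(\<lambda>e. fst (\<psi> (j e))) \<in> hom (Tot X) (Tot Y)"
    using hom_compose[OF hom_compose[OF j \<psi>]] by (simp add: o_def)
  have j_incl: "j (incl X b) = N #>\<^bsub>S\<^esub> (\<phi>1 b, \<one>\<^bsub>Tot X\<^esub>)" if b: "b \<in> carrier (Ker X)" for b
  proof -
    \<comment> \<open>The two representatives differ by the element of \<open>N\<close> belonging to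
      \<open>b\<close>. Hence \<open>j\<close> induces \<open>\<phi>1\<close> on the
      kernels.\<close>
    have "(\<one>\<^bsub>Ker Y\<^esub>, incl X b) = (inv\<^bsub>Ker Y\<^esub> (\<phi>1 b), incl X b) \<otimes>\<^bsub>S\<^esub> (\<phi>1 b, \<one>\<^bsub>Tot X\<^esub>)"
      using b by (simp add: semidirect_simps \<eta>.act_one)
    then have "(\<one>\<^bsub>Ker Y\<^esub>, incl X b) \<in> N #>\<^bsub>S\<^esub> (\<phi>1 b, \<one>\<^bsub>Tot X\<^esub>)"
      using b unfolding r_coset_def by blast
    then show ?thesis
      using N.repr_independence[OF _ _ N.is_subgroup] b
      by (simp add: j_def semidirect_simps)
  qed
  have prj_eq: "prj Y (fst (\<psi> (j e))) = \<phi>0 (prj X e)" if e: "e \<in> carrier (Tot X)" for e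
  proof -
    have "j e \<in> carrier (S Mod N)" using j e by (rule hom_in_carrier)
    then have "\<psi> (j e) \<in> carrier (Tot PB)" "snd (\<psi> (j e)) = prj X e"
      using \<psi> prj prj_pushforward[of "\<one>\<^bsub>Ker Y\<^esub>" e] e by (auto simp: j_def hom_in_carrier)
    then show ?thesis by (auto simp: pullback_simps)
  qed
  have "(\<lambda>e\<in>carrier (Tot X). fst (\<psi> (j e))) \<in> OPEXT \<phi>0 \<phi>1 X Y"
    unfolding OPEXT_iff using hom by (auto simp: hom_def j_incl incl prj_eq)
  then show ?thesis by blast
qed

text \<open>Both constructions use maps from \<open>PF\<close> to \<open>PB\<close>, the convenient
  direction out of a quotient; \<open>ext_iso_sym\<close> reverses the isomorphism in each
  implication.\<close>

lemma OPEXT_nonempty_iff: "OPEXT \<phi>0 \<phi>1 X Y \<noteq> {} \<longleftrightarrow> ext_iso PB PF"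
proof
  assume "OPEXT \<phi>0 \<phi>1 X Y \<noteq> {}"
  then have iso: "ext_iso PF PB" using ext_iso_of_OPEXT by blast
  interpret N: normal N S by (rule normal_pushforward)
  show "ext_iso PB PF"
    using iso
  proof (rule ext_iso_sym)
    show "group (Tot PF)" using N.factorgroup_is_group by (simp add: pushforward_simps)
    show "incl PF \<in> carrier (Ker PF) \<rightarrow> carrier (Tot PF)"
      by (force simp: pushforward_simps FactGroup_def RCOSETS_def semidirect_simps)
  qed
next
  assume "ext_iso PB PF"
  then have "ext_iso PF PB" using group_pullback incl_pullback_closed by (rule ext_iso_sym)
  then show "OPEXT \<phi>0 \<phi>1 X Y \<noteq> {}"
    using OPEXT_nonempty_of_morphism by (auto simp: ext_iso_def)
qed

end

theorem theorem4p2: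
  fixes X :: "('b, 'e, 'c) group_ext" and X' :: "('b2, 'e2, 'c2) group_ext"
    and \<phi>0 :: "'c \<Rightarrow> 'c2" and \<phi>1 :: "'b \<Rightarrow> 'b2"
  assumes "abelian_extension X" and "abelian_extension X'"
    and "module_morphism (Quo X) (Ker X) (induced_module X)
           (Quo X') (Ker X') (induced_module X') \<phi>0 \<phi>1"
  shows "(OPEXT \<phi>0 \<phi>1 X X' \<noteq> {} \<longleftrightarrow>
            ext_iso (pullback_ext (Quo X) \<phi>0 X')
              (pushforward_ext (Ker X') (pullback_module \<phi>0 (induced_module X')) \<phi>1 X)) \<and>
         (OPEXT \<phi>0 \<phi>1 X X' \<noteq> {} \<longrightarrow>
            simply_transitive_action
              (crossed_homs (Quo X) (Ker X') (pullback_module \<phi>0 (induced_module X')))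
              (OPEXT \<phi>0 \<phi>1 X X')
              (OPEXT_action \<phi>0 \<phi>1 X X'))"
proof -
  interpret extension_module_morphism X X' \<phi>0 \<phi>1
    using assms
    by (intro extension_module_morphism.intro extension_module_morphism_axioms.intro abelian_ext.intro)
  show ?thesis using OPEXT_nonempty_iff simply_transitive_OPEXT by blast
qed

end
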